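(* For any graph $G=([n],E)$, the graph matrix $M_G$ is Reznick-certifiable, i.e., there exists a nonnegative integer $r$ such that \[\Big(\sum_{i=1}^nx_i^2\Big)^rf_G\in\Sigma .\]
   Context: Graphs are finite, simple, undirected and loopless; the vertex set is taken to be $[n]=\{1,\dots,n\}$ for some nonnegative integer $n$, and $E$ is a set of two-element subsets of $[n]$. A set $S\subseteq[n]$ is stable in $G$ if $\{i,j\}\notin E$ for all $i,j\in S$; $\alpha(G)$ is the maximum cardinality of a stable set in $G$. $A_G$ is the $n\times n$ adjacency matrix of $G$, $I$ the identity matrix and $J$ the all-ones matrix of size $n$. The graph matrix of $G$ is $M_G:=\alpha(G)(A_G+I)-J$. Let $x=(x_1,\dots,x_n)$ be a tuple of variables and $x^{\circ 2}:=(x_1^2,\dots,x_n^2)$, viewed as a column vector; the graph polynomial is $f_G:=(x^{\circ 2})^TM_Gx^{\circ 2}\in\mathbb R[x]$. $\Sigma\subseteq\mathbb R[x]=\mathbb R[x_1,\dots,x_n]$ is the set of all finite sums of squares of polynomials. A real symmetric $n\times n$ matrix $M$ is called Reznick-certifiable if $\big(\sum_{i=1}^nx_i^2\big)^r(x^{\circ 2})^TMx^{\circ 2}\in\Sigma$ for some nonnegative integer $r$. *)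

theory Defs
  imports
    "Jordan_Normal_Form.Matrix"
    "HOL-Library.Poly_Mapping"
    Complex_Main
begin

definition simple_graph :: "nat \<Rightarrow> nat set set \<Rightarrow> bool" where
  "simple_graph n E \<longleftrightarrow> E \<subseteq> {e. e \<subseteq> {1..n} \<and> card e = 2}"

definition stable :: "nat \<Rightarrow> nat set set \<Rightarrow> nat set \<Rightarrow> bool" where
  "stable n E S \<longleftrightarrow> S \<subseteq> {1..n} \<and> (\<forall>i\<in>S. \<forall>j\<in>S. {i, j} \<notin> E)"

definition stability_number :: "nat \<Rightarrow> nat set set \<Rightarrow> nat" where
  "stability_number n E = Max (card ` {S. stable n E S})"

text \<open>Matrix rows and columns are numbered from 0; row i belongs to vertex i + 1.\<close>

definition adj_mat :: "nat \<Rightarrow> nat set set \<Rightarrow> real mat" where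
  "adj_mat n E = mat n n (\<lambda>(i, j). if {Suc i, Suc j} \<in> E then 1 else 0)"

definition all_ones_mat :: "nat \<Rightarrow> real mat" where
  "all_ones_mat n = mat n n (\<lambda>_. 1)"

definition graph_mat :: "nat \<Rightarrow> nat set set \<Rightarrow> real mat" where
  "graph_mat n E =
     real (stability_number n E) \<cdot>\<^sub>m (adj_mat n E + 1\<^sub>m n) - all_ones_mat n"

text \<open>A multivariate polynomial is a finitely supported map from monomials (finitely
  supported exponent vectors) to coefficients; multiplication is convolution. The type
  has a variable for every natural number, and \<open>polys n\<close> is the subring
  of those polynomials in which only the variables with index in \<open>{1..n}\<close> occur.\<close>

type_synonym mpoly = "(nat \<Rightarrow>\<^sub>0 nat) \<Rightarrow>\<^sub>0 real"

definition Var :: "nat \<Rightarrow> mpoly" where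
  "Var i = Poly_Mapping.single (Poly_Mapping.single i 1) 1"

definition Const :: "real \<Rightarrow> mpoly" where
  "Const c = Poly_Mapping.single 0 c"

definition polys :: "nat \<Rightarrow> mpoly set" where
  "polys n = {p. \<forall>m\<in>Poly_Mapping.keys p. Poly_Mapping.keys m \<subseteq> {1..n}}"

definition sos :: "nat \<Rightarrow> mpoly set" where
  "sos n = {(\<Sum>p\<leftarrow>ps. p ^ 2) | ps. set ps \<subseteq> polys n}"

definition sq_vars :: "nat \<Rightarrow> mpoly vec" where
  "sq_vars n = vec n (\<lambda>i. Var (Suc i) ^ 2)"

definition quartic_form :: "nat \<Rightarrow> real mat \<Rightarrow> mpoly" where
  "quartic_form n M = sq_vars n \<bullet> (map_mat Const M *\<^sub>v sq_vars n)"

definition graph_poly :: "nat \<Rightarrow> nat set set \<Rightarrow> mpoly" where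
  "graph_poly n E = quartic_form n (graph_mat n E)"

definition reznick_certifiable :: "nat \<Rightarrow> real mat \<Rightarrow> bool" where
  "reznick_certifiable n M \<longleftrightarrow>
     M \<in> carrier_mat n n \<and> transpose_mat M = M \<and>
     (\<exists>r::nat. (\<Sum>i=1..n. Var i ^ 2) ^ r * quartic_form n M \<in> sos n)"

end

theory Submission
  imports Defs
begin

text \<open>Put \<open>y\<^sub>i = x\<^sub>i\<^sup>2\<close>, \<open>Q = A\<^sub>G + I\<close>, and for a vertex set \<open>V\<close> let \<open>s\<^sub>V\<close> be the sum of the
  \<open>y\<^sub>i\<close> and \<open>q\<^sub>V\<close> the quadratic form of \<open>Q\<close> in the \<open>y\<^sub>i\<close>, \<open>i \<in> V\<close>. By induction on \<open>a\<close>, if all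
  stable sets in \<open>V\<close> have at most \<open>a\<close> elements, then \<open>s\<^sub>V\<^sup>r (a q\<^sub>V - s\<^sub>V\<^sup>2)\<close> is a sum of squares for
  some \<open>r\<close>. Two facts make the step from \<open>a\<close> to \<open>a + 1\<close> work.

  First, let \<open>W\<^sub>i\<close> consist of the non-neighbours of \<open>i\<close> in \<open>V\<close>, and let \<open>z\<^sub>i\<close> be the sum of the
  \<open>y\<^sub>j\<close> over the closed neighbourhood of \<open>i\<close>. Up to a cubic form with nonnegative coefficients,
  \<open>s\<^sub>V ((a + 1) q\<^sub>V - s\<^sub>V\<^sup>2)\<close> is the sum of the \<open>y\<^sub>i F\<^sub>i\<close>, where
  \<open>F\<^sub>i = (a + 1) (q\<^bsub>W\<^sub>i\<^esub> + z\<^sub>i\<^sup>2) - s\<^sub>V\<^sup>2\<close> belongs to the graph in which the closed neighbourhood of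
  \<open>i\<close> is contracted to an isolated vertex.

  Second, isolated vertices are harmless. With \<open>s = s\<^bsub>W\<^sub>i\<^esub>\<close>, \<open>q = q\<^bsub>W\<^sub>i\<^esub>\<close>, \<open>z = z\<^sub>i\<close> and
  \<open>u = a z - s\<close> one has \<open>a F\<^sub>i = u\<^sup>2 + (a + 1) (a q - s\<^sup>2)\<close>. The form \<open>a q - s\<^sup>2\<close> is certified only
  after multiplication by \<open>s\<^sup>r\<close>, but for large \<open>N\<close> we can write \<open>(s + z)\<^sup>N = s\<^sup>r P + u\<^sup>2 H\<close> with
  nonnegative coefficients in \<open>P\<close> and \<open>H\<close>, where \<open>H\<close> is so small that \<open>(s + z)\<^sup>N u\<^sup>2\<close>
  compensates for the negative part of \<open>(a + 1) u\<^sup>2 H (a q - s\<^sup>2)\<close>.\<close>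

section \<open>Closure properties of sums of squares\<close>

lemma polys_zero [simp]: "0 \<in> polys n"
  and polys_Const [simp]: "Const c \<in> polys n"
  by (auto simp: polys_def Const_def)

lemma polys_Var: "i \<in> {1..n} \<Longrightarrow> Var i \<in> polys n"
  by (auto simp: polys_def Var_def)

lemma polys_add: "p \<in> polys n \<Longrightarrow> q \<in> polys n \<Longrightarrow> p + q \<in> polys n"
  using Poly_Mapping.keys_add[of p q] unfolding polys_def by blast

lemma polys_uminus: "p \<in> polys n \<Longrightarrow> - p \<in> polys n"
  by (simp add: polys_def)

lemma polys_diff: "p \<in> polys n \<Longrightarrow> q \<in> polys n \<Longrightarrow> p - q \<in> polys n"
  using polys_add[OF _ polys_uminus] by simp

lemma polys_mult:
  assumes "p \<in> polys n" "q \<in> polys n"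
  shows "p * q \<in> polys n"
  unfolding polys_def
proof (intro CollectI ballI)
  fix m assume "m \<in> Poly_Mapping.keys (p * q)"
  then obtain a b where "a \<in> Poly_Mapping.keys p" "b \<in> Poly_Mapping.keys q" "m = a + b"
    using keys_mult[of p q] by blast
  with assms show "Poly_Mapping.keys m \<subseteq> {1..n}"
    using Poly_Mapping.keys_add[of a b] unfolding polys_def by blast
qed

lemma Const_0 [simp]: "Const 0 = 0"
  and Const_1 [simp]: "Const 1 = 1"
  and Const_add: "Const (a + b) = Const a + Const b"
  and Const_diff: "Const (a - b) = Const a - Const b"
  and Const_mult: "Const (a * b) = Const a * Const b"
  by (simp_all add: Const_def single_add single_diff mult_single)

lemma Const_of_nat: "Const (of_nat k) = of_nat k"
  by (induction k) (simp_all add: Const_add)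

lemma sos_zero [simp]: "0 \<in> sos n"
  unfolding sos_def by (intro CollectI exI[of _ "[]"]) simp

lemma sos_power2: "p \<in> polys n \<Longrightarrow> p ^ 2 \<in> sos n"
  unfolding sos_def by (intro CollectI exI[of _ "[p]"]) simp

lemma sos_add:
  assumes "p \<in> sos n" "q \<in> sos n"
  shows "p + q \<in> sos n"
proof -
  obtain ps qs where "p = (\<Sum>p\<leftarrow>ps. p ^ 2)" "set ps \<subseteq> polys n"
      "q = (\<Sum>p\<leftarrow>qs. p ^ 2)" "set qs \<subseteq> polys n"
    using assms unfolding sos_def by blast
  then show ?thesis
    unfolding sos_def by (intro CollectI exI[of _ "ps @ qs"]) simp
qed

text \<open>Peels one square at a time off a representing list, so that later proofs need not handle
  lists.\<close>

lemma sos_induct [consumes 1, case_names zero add]: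
  assumes "p \<in> sos n" and "Q 0"
    and "\<And>q r. q \<in> polys n \<Longrightarrow> r \<in> sos n \<Longrightarrow> Q r \<Longrightarrow> Q (q ^ 2 + r)"
  shows "Q p"
proof -
  obtain ps where p: "p = (\<Sum>p\<leftarrow>ps. p ^ 2)" and ps: "set ps \<subseteq> polys n"
    using assms(1) unfolding sos_def by blast
  from ps have "Q (\<Sum>p\<leftarrow>ps. p ^ 2)"
  proof (induction ps)
    case (Cons q ps)
    moreover have "(\<Sum>p\<leftarrow>ps. p ^ 2) \<in> sos n"
      using Cons.prems unfolding sos_def by auto
    ultimately show ?case
      using assms(3) by simp
  qed (use assms(2) in simp)
  with p show ?thesis
    by simp
qed

lemma sos_imp_polys: "p \<in> sos n \<Longrightarrow> p \<in> polys n"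
  by (induction rule: sos_induct) (simp_all add: polys_add polys_mult power2_eq_square)

lemma sos_mult:
  assumes "p \<in> sos n" "q \<in> sos n"
  shows "p * q \<in> sos n"
  using assms(1)
proof (induction rule: sos_induct)
  case (add a p)
  have "a ^ 2 * q \<in> sos n"
    using assms(2)
  proof (induction rule: sos_induct)
    case (add b q)
    have "a ^ 2 * (b ^ 2 + q) = (a * b) ^ 2 + a ^ 2 * q"
      by (simp add: algebra_simps power_mult_distrib)
    then show ?case
      using add sos_add sos_power2 polys_mult \<open>a \<in> polys n\<close> by simp
  qed simp
  with add show ?case
    by (simp add: distrib_right sos_add)
qed simp

lemma sos_Const: "0 \<le> c \<Longrightarrow> Const c \<in> sos n"
  using sos_power2[OF polys_Const[of "sqrt c" n]]
  by (simp add: power2_eq_square flip: Const_mult)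

lemma sos_one [simp]: "1 \<in> sos n"
  using sos_Const[of 1] by simp

lemma sos_power: "p \<in> sos n \<Longrightarrow> p ^ k \<in> sos n"
  by (induction k) (simp_all add: sos_mult)

lemma sos_sum: "(\<And>i. i \<in> I \<Longrightarrow> f i \<in> sos n) \<Longrightarrow> sum f I \<in> sos n"
  by (induction I rule: infinite_finite_induct) (simp_all add: sos_add)

lemma sos_monomial:
  "0 \<le> c \<Longrightarrow> s \<in> sos n \<Longrightarrow> z \<in> sos n \<Longrightarrow> Const c * s ^ i * z ^ j \<in> sos n"
  by (simp add: sos_Const sos_mult sos_power)

text \<open>Coefficients of \<open>(1 + t)\<^sup>N / (a - t)\<close> and of \<open>(1 + t)\<^sup>N / (a - t)\<^sup>2\<close>. Truncating the second
  series and homogenizing with \<open>t = s / z\<close> yields the form \<open>H\<close>.\<close>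

fun series1 :: "real \<Rightarrow> nat \<Rightarrow> nat \<Rightarrow> real" where
  "series1 a N 0 = 1 / a"
| "series1 a N (Suc k) = (real (N choose Suc k) + series1 a N k) / a"

fun series2 :: "real \<Rightarrow> nat \<Rightarrow> nat \<Rightarrow> real" where
  "series2 a N 0 = series1 a N 0 / a"
| "series2 a N (Suc k) = (series1 a N (Suc k) + series2 a N k) / a"

section \<open>Size of the series coefficients for large \<open>N\<close>\<close>

lemma series1_nonneg: "0 < a \<Longrightarrow> 0 \<le> series1 a N k"
  by (induction k) simp_all

lemma series2_nonneg: "0 < a \<Longrightarrow> 0 \<le> series2 a N k"
  by (induction k) (simp_all add: series1_nonneg del: series1.simps)

text \<open>For fixed \<open>k\<close> the ratio of consecutive binomial coefficients is (N - k) /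
  (k + 1), which is unbounded in \<open>N\<close>.\<close>

lemma eventually_mult_choose_le:
  "eventually (\<lambda>N. C * real (N choose k) \<le> real (N choose Suc k)) sequentially"
proof -
  obtain m :: nat where m: "C * real (Suc k) \<le> real m"
    using real_arch_simple by blast
  have "C * real (N choose k) \<le> real (N choose Suc k)" if "m + k \<le> N" for N
  proof -
    have "Suc k * (N choose Suc k) = (N - k) * (N choose k)"
      by (simp only: binomial_absorption binomial_absorb_comp)
    then have eq: "real (Suc k) * real (N choose Suc k) = real (N - k) * real (N choose k)"
      by (metis of_nat_mult)
    have "real (Suc k) * (C * real (N choose k)) = (C * real (Suc k)) * real (N choose k)"
      by simp
    also have "\<dots> \<le> real (N - k) * real (N choose k)"
      using m that by (intro mult_right_mono) linarith+
    finally show ?thesis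
      unfolding eq[symmetric] by (subst (asm) mult_le_cancel_left_pos) simp_all
  qed
  then show ?thesis
    unfolding eventually_sequentially by blast
qed

lemma eventually_series1_le:
  assumes "1 \<le> a"
  shows "eventually (\<lambda>N. series1 a N k \<le> 2 * real (N choose k)) sequentially"
proof (induction k)
  case 0
  show ?case
    using assms by (simp add: field_simps)
next
  case (Suc k)
  show ?case
    using Suc eventually_mult_choose_le[of 2 k]
  proof eventually_elim
    case (elim N)
    have "series1 a N (Suc k) \<le> (real (N choose Suc k) + series1 a N k) / 1"
      unfolding series1.simps using assms series1_nonneg[of a N k]
      by (intro divide_left_mono) simp_all
    with elim show ?case
      by simp
  qed
qed

lemma eventually_series2_le:
  assumes "1 \<le> a"
  shows "eventually (\<lambda>N. series2 a N k \<le> 3 * real (N choose k)) sequentially"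
proof (induction k)
  case 0
  have "1 \<le> a * a"
    using assms mult_mono[of 1 a 1 a] by simp
  then show ?case
    using assms by (simp add: field_simps)
next
  case (Suc k)
  show ?case
    using Suc eventually_series1_le[OF assms, of "Suc k"] eventually_mult_choose_le[of 3 k]
  proof eventually_elim
    case (elim N)
    have "series2 a N (Suc k) \<le> (series1 a N (Suc k) + series2 a N k) / 1"
      unfolding series2.simps using assms series1_nonneg[of a N "Suc k"] series2_nonneg[of a N k]
      by (intro divide_left_mono) simp_all
    with elim show ?case
      by simp
  qed
qed

text \<open>For fixed \<open>k\<close> the coefficient \<open>series2 a N k\<close> is at most of
  order N^k, two orders below the binomial coefficient. The shift by two matches the factor
  \<open>s ^ 2\<close> by which \<open>H\<close> is later multiplied.\<close>

lemma eventually_mult_series2_le: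
  assumes "1 \<le> a" "0 \<le> C"
  shows "eventually (\<lambda>N. C * series2 a N k \<le> real (N choose (k + 2))) sequentially"
  using eventually_series2_le[OF assms(1), of k]
    eventually_mult_choose_le[of "3 * C" k] eventually_mult_choose_le[of 1 "Suc k"]
proof eventually_elim
  case (elim N)
  have "C * series2 a N k \<le> C * (3 * real (N choose k))"
    using elim(1) assms(2) by (rule mult_left_mono)
  with elim show ?case
    by simp
qed

section \<open>Adding an isolated vertex\<close>

text \<open>The recursion makes \<open>g\<close> the coefficient sequence of the quotient of the
  series \<open>d\<close> by a - t. Multiplying back telescopes, and the truncation at
  \<open>r\<close> leaves one boundary term.\<close>

lemma mult_truncated_series:
  fixes s z :: mpoly
  assumes "a * g 0 = d 0" and "\<And>k. a * g (Suc k) = d (Suc k) + g k" and "r \<le> M"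
  shows "(Const a * z - s) * (\<Sum>k\<le>r. Const (g k) * s ^ k * z ^ (M - k)) =
    (\<Sum>k\<le>r. Const (d k) * s ^ k * z ^ (Suc M - k)) - Const (g r) * s ^ Suc r * z ^ (M - r)"
  using assms(3)
proof (induction r)
  case 0
  show ?case
    by (simp add: Const_mult algebra_simps flip: assms(1))
next
  case (Suc r)
  have eq: "Const a * Const (g (Suc r)) = Const (d (Suc r)) + Const (g r)"
    using assms(2)[of r] by (simp flip: Const_mult Const_add)
  have z: "z ^ (M - r) = z * z ^ (M - Suc r)"
    using Suc.prems by (simp flip: power_Suc add: Suc_diff_Suc)
  have "(Const a * z - s) * (Const (g (Suc r)) * s ^ Suc r * z ^ (M - Suc r)) =
      (Const a * Const (g (Suc r))) * s ^ Suc r * (z * z ^ (M - Suc r))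
      - Const (g (Suc r)) * s ^ Suc (Suc r) * z ^ (M - Suc r)"
    by (simp add: algebra_simps)
  also have "\<dots> = Const (d (Suc r)) * s ^ Suc r * z ^ (M - r) + Const (g r) * s ^ Suc r * z ^ (M - r)
      - Const (g (Suc r)) * s ^ Suc (Suc r) * z ^ (M - Suc r)"
    unfolding eq z by (simp add: algebra_simps)
  finally show ?case
    using Suc by (simp add: distrib_left)
qed

text \<open>Multiplying the truncated quotient back by (a - t)^2 recovers (1 + t)^N through degree
  \<open>r\<close>; hence the error is divisible by \<open>s ^ Suc r\<close>.\<close>

lemma power_eq_truncated_series:
  assumes s: "s \<in> sos n" and z: "z \<in> sos n" and a: "1 \<le> a"
  obtains N P H where "P \<in> sos n" "H \<in> sos n"
    "(s + z) ^ N = s ^ Suc r * P + (Const a * z - s) ^ 2 * H"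
    "(s + z) ^ N - Const (a + 1) * s ^ 2 * H \<in> sos n"
proof -
  have "eventually (\<lambda>N. \<forall>k\<in>{..r}. (a + 1) * series2 a N k \<le> real (N choose (k + 2))) sequentially"
    using a by (intro eventually_ball_finite ballI eventually_mult_series2_le) simp_all
  then obtain M where M: "\<And>N k. M \<le> N \<Longrightarrow> k \<le> r \<Longrightarrow> (a + 1) * series2 a N k \<le> real (N choose (k + 2))"
    unfolding eventually_sequentially by blast
  \<comment> \<open>\<open>H\<close> is homogeneous of degree \<open>r + M\<close> in
    \<open>s\<close> and \<open>z\<close>, and \<open>u ^ 2\<close> adds two. Also
    \<open>M \<le> N\<close>, so the bounds apply.\<close>
  define N where "N = r + Suc (Suc M)"
  define b c where "b = series1 a N" and "c = series2 a N"
  have b: "0 \<le> b k" and c: "0 \<le> c k" for k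
    using a by (simp_all add: b_def c_def series1_nonneg series2_nonneg)
  have bound: "(a + 1) * c k \<le> real (N choose (k + 2))" if "k \<le> r" for k
    using M[of N k] that by (simp add: N_def c_def)
  define u where "u = Const a * z - s"
  define H where "H = (\<Sum>k\<le>r. Const (c k) * s ^ k * z ^ (r + M - k))"
  define f where "f k = Const (real (N choose k)) * s ^ k * z ^ (N - k)" for k
  \<comment> \<open>The two boundary terms of the truncations enter in degrees \<open>r + 1\<close>
    and \<open>r + 2\<close> of \<open>s\<close>. The only negative one, \<open>- c r\<close>, is
    dominated by the binomial coefficient beside it.\<close>
  define P where "P = Const (real (N choose Suc r) + b r + a * c r) * z ^ Suc M
    + Const (real (N choose (r + 2)) - c r) * s * z ^ M
    + (\<Sum>k=r+3..N. Const (real (N choose k)) * s ^ (k - Suc r) * z ^ (N - k))"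
  have pow: "(s + z) ^ N = (\<Sum>k\<le>N. f k)"
    by (simp add: binomial_ring f_def Const_of_nat)

  have uH: "u * H = (\<Sum>k\<le>r. Const (b k) * s ^ k * z ^ (Suc (r + M) - k))
      - Const (c r) * s ^ Suc r * z ^ M"
    unfolding u_def H_def using a
    by (subst mult_truncated_series[where d = b]) (simp_all add: b_def c_def)
  have "u * (\<Sum>k\<le>r. Const (b k) * s ^ k * z ^ (Suc (r + M) - k)) =
      (\<Sum>k\<le>r. f k) - Const (b r) * s ^ Suc r * z ^ Suc M"
    unfolding u_def using a
    by (subst mult_truncated_series[where d = "\<lambda>k. real (N choose k)"])
      (simp_all add: b_def f_def N_def Suc_diff_le)
  then have uuH: "u ^ 2 * H = (\<Sum>k\<le>r. f k) - Const (b r) * s ^ Suc r * z ^ Suc M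
      - u * (Const (c r) * s ^ Suc r * z ^ M)"
    by (simp add: power2_eq_square mult.assoc uH right_diff_distrib)

  have tail: "(\<Sum>k=r+3..N. f k) =
      s ^ Suc r * (\<Sum>k=r+3..N. Const (real (N choose k)) * s ^ (k - Suc r) * z ^ (N - k))"
    unfolding sum_distrib_left
  proof (rule sum.cong)
    fix k assume "k \<in> {r+3..N}"
    then have "s ^ k = s ^ Suc r * s ^ (k - Suc r)"
      by (simp flip: power_add del: power_Suc)
    then show "f k = s ^ Suc r * (Const (real (N choose k)) * s ^ (k - Suc r) * z ^ (N - k))"
      by (simp add: f_def mult_ac)
  qed simp
  have "(\<Sum>k\<le>N. f k) = (\<Sum>k\<le>r. f k) + (\<Sum>k=Suc r..N. f k)"
    unfolding N_def by (rule sum_up_index_split)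
  also have "(\<Sum>k=Suc r..N. f k) = f (Suc r) + f (r + 2) + (\<Sum>k=r+3..N. f k)"
    using sum.atLeast_Suc_atMost[of "Suc r" N f] sum.atLeast_Suc_atMost[of "Suc (Suc r)" N f]
    by (simp add: N_def add.assoc numeral_3_eq_3)
  finally have split: "(\<Sum>k\<le>N. f k) - (\<Sum>k\<le>r. f k) = f (Suc r) + f (r + 2) + (\<Sum>k=r+3..N. f k)"
    by simp
  have "(s + z) ^ N - u ^ 2 * H = ((\<Sum>k\<le>N. f k) - (\<Sum>k\<le>r. f k))
      + Const (b r) * s ^ Suc r * z ^ Suc M + u * (Const (c r) * s ^ Suc r * z ^ M)"
    unfolding pow uuH by (simp add: algebra_simps)
  also have "\<dots> = s ^ Suc r * P"
    unfolding split tail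
    by (simp add: P_def u_def f_def N_def Const_add Const_diff Const_mult algebra_simps)
  finally have eq: "(s + z) ^ N = s ^ Suc r * P + u ^ 2 * H"
    by (simp add: algebra_simps)

  have "c r \<le> (a + 1) * c r"
    using a c[of r] by (simp add: algebra_simps)
  then have "c r \<le> real (N choose (r + 2))"
    using bound[of r] by simp
  then have "P \<in> sos n"
    unfolding P_def using a s z b c
    by (intro sos_add sos_sum sos_monomial sos_mult sos_power sos_Const) simp_all
  moreover have "H \<in> sos n"
    unfolding H_def using s z c by (intro sos_sum sos_monomial)
  moreover have "(s + z) ^ N - Const (a + 1) * s ^ 2 * H \<in> sos n"
  proof -
    \<comment> \<open>The term of \<open>s ^ 2 * H\<close> with index \<open>k\<close> is compared
      with the binomial term \<open>f (k + 2)\<close>.\<close>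
    have exponent: "N - Suc (Suc k) = r + M - k" for k
      by (simp add: N_def)
    have "(\<Sum>k\<le>N. f k) = f 0 + f 1 + (\<Sum>k\<le>r + M. f (k + 2))"
      unfolding N_def by (simp only: add_Suc_right sum.atMost_Suc_shift) (simp add: add.assoc)
    also have "(\<Sum>k\<le>r + M. f (k + 2)) = (\<Sum>k\<le>r. f (k + 2)) + (\<Sum>k=Suc r..r+M. f (k + 2))"
      by (rule sum_up_index_split)
    finally have "(s + z) ^ N - Const (a + 1) * s ^ 2 * H = f 0 + f 1
        + (\<Sum>k\<le>r. f (k + 2) - Const (a + 1) * s ^ 2 * (Const (c k) * s ^ k * z ^ (r + M - k)))
        + (\<Sum>k=Suc r..r+M. f (k + 2))"
      unfolding pow H_def by (simp add: sum_subtractf sum_distrib_left)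
    also have "(\<Sum>k\<le>r. f (k + 2) - Const (a + 1) * s ^ 2 * (Const (c k) * s ^ k * z ^ (r + M - k))) =
        (\<Sum>k\<le>r. Const (real (N choose (k + 2)) - (a + 1) * c k) * s ^ (k + 2) * z ^ (r + M - k))"
      by (intro sum.cong refl)
        (simp add: f_def exponent Const_add Const_diff Const_mult power2_eq_square algebra_simps)
    finally have eq2: "(s + z) ^ N - Const (a + 1) * s ^ 2 * H = f 0 + f 1
        + (\<Sum>k\<le>r. Const (real (N choose (k + 2)) - (a + 1) * c k) * s ^ (k + 2) * z ^ (r + M - k))
        + (\<Sum>k=Suc r..r+M. f (k + 2))" .
    have f: "f k \<in> sos n" for k
      unfolding f_def using s z by (intro sos_monomial) simp_all
    have g: "Const (real (N choose (k + 2)) - (a + 1) * c k) * s ^ (k + 2) * z ^ (r + M - k)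
        \<in> sos n" if "k \<le> r" for k
      by (rule sos_monomial[OF _ s z]) (use bound[OF that] in linarith)
    show ?thesis
      unfolding eq2 by (intro sos_add sos_sum f g) simp
  qed
  ultimately show ?thesis
    using that eq unfolding u_def by blast
qed

lemma sos_add_isolated_vertex:
  assumes s: "s \<in> sos n" and z: "z \<in> sos n" and q: "q \<in> sos n" and a: "1 \<le> a"
    and f: "s ^ r * (Const a * q - s ^ 2) \<in> sos n"
  shows "\<exists>N. (s + z) ^ N * (Const (a + 1) * (q + z ^ 2) - (s + z) ^ 2) \<in> sos n"
proof -
  define u where "u = Const a * z - s"
  obtain N P H where P: "P \<in> sos n" and H: "H \<in> sos n"
    and eq: "(s + z) ^ N = s ^ Suc r * P + u ^ 2 * H"
    and rest: "(s + z) ^ N - Const (a + 1) * s ^ 2 * H \<in> sos n"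
    unfolding u_def by (rule power_eq_truncated_series[OF s z a])
  define X where "X = (s + z) ^ N"
  define F where "F = Const (a + 1) * (q + z ^ 2) - (s + z) ^ 2"
  have "Const a * F = u ^ 2 + Const (a + 1) * (Const a * q - s ^ 2)"
    by (simp add: F_def u_def Const_add power2_eq_square algebra_simps)
  then have "Const a * (X * F) = u ^ 2 * X + Const (a + 1) * (Const a * q - s ^ 2) * X"
    by (simp only: mult.left_commute[of "Const a" X]) (simp add: algebra_simps)
  also have "Const (a + 1) * (Const a * q - s ^ 2) * X =
      Const (a + 1) * (Const a * q - s ^ 2) * (s ^ Suc r * P + u ^ 2 * H)"
    by (simp add: X_def eq)
  \<comment> \<open>The only negative contribution, \<open>s ^ 2\<close> times
    \<open>u ^ 2 * H\<close>, is charged to \<open>u ^ 2 * X\<close>. The three summands are then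
    covered by \<open>rest\<close>, by \<open>f\<close>, and by \<open>q\<close> being a sum of
    squares.\<close>
  also have "u ^ 2 * X + \<dots> = u ^ 2 * (X - Const (a + 1) * s ^ 2 * H)
      + Const (a + 1) * s * P * (s ^ r * (Const a * q - s ^ 2))
      + u ^ 2 * Const (a + 1) * Const a * H * q"
    by (simp add: algebra_simps)
  also have "\<dots> \<in> sos n"
  proof -
    have "u ^ 2 \<in> sos n"
      unfolding u_def using s z
      by (intro sos_power2 polys_diff polys_mult polys_Const sos_imp_polys)
    then show ?thesis
      using a s q P H f rest
      by (intro sos_add sos_mult[OF _ f] sos_mult sos_Const) (simp_all add: X_def)
  qed
  finally have "Const (1 / a) * (Const a * (X * F)) \<in> sos n"
    using a by (simp add: sos_mult sos_Const)
  moreover have "Const (1 / a) * (Const a * (X * F)) = X * F"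
    using a by (simp add: Const_mult[symmetric] mult.assoc[symmetric])
  ultimately show ?thesis
    unfolding X_def F_def by auto
qed

section \<open>Cubic identity and closed-neighbourhood forms\<close>

text \<open>With p = \<open>Q i j\<close> and q = \<open>Q i k\<close>, the weight 1 of each triple
  splits as (1 - p)(1 - q) + q + p(1 - q).\<close>

lemma cubic_identity:
  fixes y :: "'v \<Rightarrow> 'a :: comm_ring_1"
  assumes sym: "\<And>i j. Q i j = Q j i"
  shows "(\<Sum>i\<in>V. y i) * (\<Sum>j\<in>V. \<Sum>k\<in>V. Q j k * y j * y k) =
    (\<Sum>i\<in>V. y i * ((\<Sum>j\<in>V. \<Sum>k\<in>V. (1 - Q i j) * (1 - Q i k) * Q j k * y j * y k)
      + (\<Sum>j\<in>V. Q i j * y j) ^ 2))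
    + (\<Sum>i\<in>V. \<Sum>j\<in>V. \<Sum>k\<in>V. Q i j * Q j k * (1 - Q i k) * y i * y j * y k)"
proof -
  define w where "w i j k = y i * y j * y k" for i j k
  have "(\<Sum>i\<in>V. \<Sum>j\<in>V. \<Sum>k\<in>V. Q j k * Q i k * w i j k) =
      (\<Sum>i\<in>V. \<Sum>k\<in>V. \<Sum>j\<in>V. Q j k * Q i k * w i j k)"
    by (intro sum.cong refl sum.swap)
  also have "\<dots> = (\<Sum>k\<in>V. \<Sum>i\<in>V. \<Sum>j\<in>V. Q j k * Q i k * w i j k)"
    by (rule sum.swap)
  also have "\<dots> = (\<Sum>i\<in>V. \<Sum>j\<in>V. \<Sum>k\<in>V. Q i j * Q i k * w i j k)"
    by (intro sum.cong refl) (simp add: w_def sym mult_ac)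
  txt \<open>The products \<open>Q j k * Q i k\<close> are paths with centre \<open>k\<close>; rotating the names turns them
    into paths with centre \<open>i\<close>, which are what the square of the neighbourhood sum consists of.\<close>
  finally have relabel: "(\<Sum>i\<in>V. \<Sum>j\<in>V. \<Sum>k\<in>V. Q j k * Q i k * w i j k) =
      (\<Sum>i\<in>V. \<Sum>j\<in>V. \<Sum>k\<in>V. Q i j * Q i k * w i j k)" .

  have "(\<Sum>i\<in>V. y i) * (\<Sum>j\<in>V. \<Sum>k\<in>V. Q j k * y j * y k) =
      (\<Sum>i\<in>V. \<Sum>j\<in>V. \<Sum>k\<in>V. Q j k * w i j k)"
    by (simp only: sum_distrib_right) (simp add: sum_distrib_left w_def mult_ac)
  also have "\<dots> = (\<Sum>i\<in>V. \<Sum>j\<in>V. \<Sum>k\<in>V. (1 - Q i j) * (1 - Q i k) * Q j k * w i j k)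
      + (\<Sum>i\<in>V. \<Sum>j\<in>V. \<Sum>k\<in>V. Q j k * Q i k * w i j k)
      + (\<Sum>i\<in>V. \<Sum>j\<in>V. \<Sum>k\<in>V. Q i j * Q j k * (1 - Q i k) * w i j k)"
    unfolding sum.distrib[symmetric]
    by (intro sum.cong refl) (simp add: algebra_simps)
  also have "\<dots> = (\<Sum>i\<in>V. \<Sum>j\<in>V. \<Sum>k\<in>V. (1 - Q i j) * (1 - Q i k) * Q j k * w i j k)
      + (\<Sum>i\<in>V. \<Sum>j\<in>V. \<Sum>k\<in>V. Q i j * Q i k * w i j k)
      + (\<Sum>i\<in>V. \<Sum>j\<in>V. \<Sum>k\<in>V. Q i j * Q j k * (1 - Q i k) * w i j k)"
    unfolding relabel ..
  also have "(\<Sum>i\<in>V. \<Sum>j\<in>V. \<Sum>k\<in>V. Q i j * Q i k * w i j k) =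
      (\<Sum>i\<in>V. y i * (\<Sum>j\<in>V. Q i j * y j) ^ 2)"
    by (simp add: power2_eq_square sum_product sum_distrib_left w_def mult_ac)
  also have "(\<Sum>i\<in>V. \<Sum>j\<in>V. \<Sum>k\<in>V. (1 - Q i j) * (1 - Q i k) * Q j k * w i j k) =
      (\<Sum>i\<in>V. y i * (\<Sum>j\<in>V. \<Sum>k\<in>V. (1 - Q i j) * (1 - Q i k) * Q j k * y j * y k))"
    by (simp add: sum_distrib_left w_def mult_ac)
  finally show ?thesis
    by (simp add: distrib_left sum.distrib w_def mult.assoc)
qed

definition closed_adj :: "nat set set \<Rightarrow> nat \<Rightarrow> nat \<Rightarrow> mpoly" where
  "closed_adj E i j = (if i = j \<or> {i, j} \<in> E then 1 else 0)"

definition vertex_sum :: "nat set \<Rightarrow> mpoly" where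
  "vertex_sum V = (\<Sum>i\<in>V. Var i ^ 2)"

definition closed_adj_form :: "nat set set \<Rightarrow> nat set \<Rightarrow> mpoly" where
  "closed_adj_form E V = (\<Sum>i\<in>V. \<Sum>j\<in>V. closed_adj E i j * Var i ^ 2 * Var j ^ 2)"

definition non_neighbours :: "nat set set \<Rightarrow> nat set \<Rightarrow> nat \<Rightarrow> nat set" where
  "non_neighbours E V i = {j \<in> V. j \<noteq> i \<and> {i, j} \<notin> E}"

lemma closed_adj_sym: "closed_adj E i j = closed_adj E j i"
  by (auto simp: closed_adj_def insert_commute)

lemma sos_closed_adj: "closed_adj E i j \<in> sos n"
  and sos_one_minus_closed_adj: "1 - closed_adj E i j \<in> sos n"
  by (simp_all add: closed_adj_def)

lemma sos_Var: "i \<in> {1..n} \<Longrightarrow> Var i ^ 2 \<in> sos n"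
  by (intro sos_power2 polys_Var)

lemma sos_vertex_sum: "V \<subseteq> {1..n} \<Longrightarrow> vertex_sum V \<in> sos n"
  unfolding vertex_sum_def by (intro sos_sum sos_Var) auto

lemma sos_closed_adj_form: "V \<subseteq> {1..n} \<Longrightarrow> closed_adj_form E V \<in> sos n"
  unfolding closed_adj_form_def by (intro sos_sum sos_mult sos_closed_adj sos_Var) auto

lemma sum_non_neighbours:
  assumes "finite V"
  shows "sum f (non_neighbours E V i) = (\<Sum>j\<in>V. (1 - closed_adj E i j) * f j)"
  unfolding non_neighbours_def sum.inter_filter[OF assms]
  by (intro sum.cong) (auto simp: closed_adj_def)

lemma closed_adj_form_non_neighbours:
  assumes "finite V"
  shows "closed_adj_form E (non_neighbours E V i) = (\<Sum>j\<in>V. \<Sum>k\<in>V.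
    (1 - closed_adj E i j) * (1 - closed_adj E i k) * closed_adj E j k * Var j ^ 2 * Var k ^ 2)"
  unfolding closed_adj_form_def sum_non_neighbours[OF assms]
  by (simp add: sum_distrib_left mult.assoc)

section \<open>Induction on the bound for stable sets\<close>

text \<open>With \<open>a\<close> only an upper bound, the induction applies to every
  \<open>W i\<close>, whatever its exact stability number: adding \<open>i\<close> to a stable set
  in \<open>W i\<close> keeps it stable.\<close>

lemma exists_sos_stable_bound:
  assumes E: "simple_graph n E" and "V \<subseteq> {1..n}"
    and "\<And>S. stable n E S \<Longrightarrow> S \<subseteq> V \<Longrightarrow> card S \<le> a"
  shows "\<exists>r. vertex_sum V ^ r * (Const (real a) * closed_adj_form E V - vertex_sum V ^ 2) \<in> sos n"
  using assms(2,3)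
proof (induction a arbitrary: V)
  have loop: "{i} \<notin> E" for i
    using E by (auto simp: simple_graph_def)
  case 0
  have "stable n E {i}" if "i \<in> V" for i
    using that 0(1) loop by (auto simp: stable_def)
  then have "V = {}"
    using 0(2) by fastforce
  then show ?case
    by (simp add: vertex_sum_def)
next
  case (Suc a)
  have loop: "{i} \<notin> E" for i
    using E by (auto simp: simple_graph_def)
  have fin: "finite V"
    using Suc.prems(1) finite_subset by blast
  define Q where "Q = closed_adj E"
  define \<sigma> where "\<sigma> = vertex_sum V"
  define A where "A = Const (real (Suc a))"
  define W where "W = non_neighbours E V"
  define nb where "nb i = (\<Sum>j\<in>V. Q i j * Var j ^ 2)" for i
  define F where "F i = A * (closed_adj_form E (W i) + nb i ^ 2) - \<sigma> ^ 2" for i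
  have W: "W i \<subseteq> V" for i
    by (auto simp: W_def non_neighbours_def)
  have nb: "nb i \<in> sos n" for i
    unfolding nb_def Q_def using Suc.prems(1)
    by (intro sos_sum sos_mult sos_closed_adj sos_Var) auto
  have \<sigma>: "\<sigma> \<in> sos n"
    unfolding \<sigma>_def using Suc.prems(1) by (rule sos_vertex_sum)
  have \<sigma>_eq: "\<sigma> = vertex_sum (W i) + nb i" for i
    unfolding \<sigma>_def vertex_sum_def W_def sum_non_neighbours[OF fin] nb_def Q_def
    by (simp add: algebra_simps flip: sum.distrib)

  have "\<exists>r. \<sigma> ^ r * F i \<in> sos n" if i: "i \<in> V" for i
  proof -
    have card: "card S \<le> a" if S: "stable n E S" "S \<subseteq> W i" for S
    proof -
      have "i \<notin> S" "finite S"
        using S W[of i] fin by (auto simp: W_def non_neighbours_def dest: finite_subset)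
      moreover have "stable n E (insert i S)"
        using S i Suc.prems(1) loop unfolding stable_def W_def non_neighbours_def
        by (auto simp: insert_commute)
      then have "card (insert i S) \<le> Suc a"
        using Suc.prems(2) S W[of i] i by blast
      ultimately show ?thesis
        by simp
    qed
    have Wn: "W i \<subseteq> {1..n}"
      using W[of i] Suc.prems(1) by blast
    show ?thesis
    \<comment> \<open>Adding an isolated vertex involves division by \<open>a\<close>. For
      \<open>a = 0\<close> the set \<open>W i\<close> is empty and \<open>F i\<close>
      vanishes.\<close>
    proof (cases "a = 0")
      case True
      have "stable n E {j}" if "j \<in> W i" for j
        using that Wn loop by (auto simp: stable_def)
      then have "W i = {}"
        using card True by fastforce
      then have "F i = 0"
        using \<sigma>_eq[of i] True by (simp add: F_def A_def vertex_sum_def closed_adj_form_def)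
      then show ?thesis
        by simp
    next
      case False
      have "\<exists>r. vertex_sum (W i) ^ r *
          (Const (real a) * closed_adj_form E (W i) - vertex_sum (W i) ^ 2) \<in> sos n"
        by (rule Suc.IH[OF Wn card])
      then obtain r where "vertex_sum (W i) ^ r *
          (Const (real a) * closed_adj_form E (W i) - vertex_sum (W i) ^ 2) \<in> sos n" ..
      from sos_add_isolated_vertex[OF sos_vertex_sum[OF Wn] nb sos_closed_adj_form[OF Wn] _ this]
      show ?thesis
        using False by (simp add: F_def A_def \<sigma>_eq[of i] add.commute)
    qed
  qed
  then obtain R where R: "\<And>i. i \<in> V \<Longrightarrow> \<sigma> ^ R i * F i \<in> sos n"
    by metis
  \<comment> \<open>A common exponent for all \<open>i\<close>; raising an exponent is harmless
    because \<open>\<sigma>\<close> is a sum of squares.\<close>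
  define N where "N = (\<Sum>i\<in>V. R i)"
  have F: "\<sigma> ^ N * F i \<in> sos n" if "i \<in> V" for i
  proof -
    have "R i \<le> N"
      unfolding N_def using fin that by (intro member_le_sum) auto
    then have eq: "\<sigma> ^ N * F i = \<sigma> ^ (N - R i) * (\<sigma> ^ R i * F i)"
      by (simp add: mult.assoc[symmetric] flip: power_add)
    show ?thesis
      unfolding eq by (rule sos_mult[OF sos_power[OF \<sigma>] R[OF that]])
  qed

  define K where "K = (\<Sum>i\<in>V. \<Sum>j\<in>V. \<Sum>k\<in>V.
    Q i j * Q j k * (1 - Q i k) * Var i ^ 2 * Var j ^ 2 * Var k ^ 2)"
  have K: "K \<in> sos n"
    unfolding K_def Q_def using Suc.prems(1)
    by (intro sos_sum sos_mult sos_closed_adj sos_one_minus_closed_adj sos_Var) auto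
  have "\<sigma> * closed_adj_form E V =
      (\<Sum>i\<in>V. Var i ^ 2 * (closed_adj_form E (W i) + nb i ^ 2)) + K"
    unfolding \<sigma>_def vertex_sum_def W_def closed_adj_form_non_neighbours[OF fin] K_def nb_def Q_def
    unfolding closed_adj_form_def by (rule cubic_identity) (rule closed_adj_sym)
  moreover have "(\<Sum>i\<in>V. Var i ^ 2 * F i) =
      (\<Sum>i\<in>V. A * (Var i ^ 2 * (closed_adj_form E (W i) + nb i ^ 2)) - Var i ^ 2 * \<sigma> ^ 2)"
    by (intro sum.cong refl) (simp add: F_def right_diff_distrib mult_ac)
  then have "(\<Sum>i\<in>V. Var i ^ 2 * F i) =
      A * (\<Sum>i\<in>V. Var i ^ 2 * (closed_adj_form E (W i) + nb i ^ 2)) - \<sigma> * \<sigma> ^ 2"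
    by (simp only: sum_subtractf sum_distrib_left[symmetric] sum_distrib_right[symmetric])
      (simp add: \<sigma>_def vertex_sum_def)
  ultimately have "\<sigma> * (A * closed_adj_form E V - \<sigma> ^ 2) = (\<Sum>i\<in>V. Var i ^ 2 * F i) + A * K"
    by (simp add: algebra_simps)
  then have "\<sigma> ^ Suc N * (A * closed_adj_form E V - \<sigma> ^ 2) =
      \<sigma> ^ N * ((\<Sum>i\<in>V. Var i ^ 2 * F i) + A * K)"
    by (simp add: mult_ac)
  also have "\<dots> = (\<Sum>i\<in>V. Var i ^ 2 * (\<sigma> ^ N * F i)) + A * (\<sigma> ^ N * K)"
    by (simp add: distrib_left sum_distrib_left mult_ac)
  also have "\<dots> \<in> sos n"
    using F K \<sigma> Suc.prems(1) unfolding A_def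
    by (intro sos_add sos_sum sos_mult[OF sos_Var F] sos_mult sos_Const sos_power) auto
  finally show ?case
    unfolding A_def \<sigma>_def by blast
qed

section \<open>From the graph matrix to the quadratic forms\<close>

lemma card_stable_le_stability_number:
  assumes "stable n E S"
  shows "card S \<le> stability_number n E"
proof -
  have "{S. stable n E S} \<subseteq> Pow {1..n}"
    by (auto simp: stable_def)
  then have "finite {S. stable n E S}"
    by (rule finite_subset) simp
  then show ?thesis
    unfolding stability_number_def using assms by (intro Max_ge) auto
qed

lemma graph_mat_carrier: "graph_mat n E \<in> carrier_mat n n"
  by (rule carrier_matI) (simp_all add: graph_mat_def adj_mat_def all_ones_mat_def)

lemma transpose_graph_mat: "transpose_mat (graph_mat n E) = graph_mat n E"
  by (rule eq_matI)
    (auto simp: graph_mat_def adj_mat_def all_ones_mat_def insert_commute)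

lemma graph_poly_eq:
  assumes "simple_graph n E"
  shows "graph_poly n E = Const (real (stability_number n E)) * closed_adj_form E {1..n}
    - vertex_sum {1..n} ^ 2"
proof -
  define \<alpha> where "\<alpha> = real (stability_number n E)"
  have loop: "{i} \<notin> E" for i
    using assms by (auto simp: simple_graph_def)
  \<comment> \<open>Looplessness makes the diagonal entries of A_G + I equal to 1 instead of
    2.\<close>
  have entry: "Const (graph_mat n E $$ (i, j)) = Const \<alpha> * closed_adj E (Suc i) (Suc j) - 1"
    if "i < n" "j < n" for i j
  proof -
    have "graph_mat n E $$ (i, j) = \<alpha> * (if i = j \<or> {Suc i, Suc j} \<in> E then 1 else 0) - 1"
      using that loop
      by (auto simp: graph_mat_def adj_mat_def all_ones_mat_def \<alpha>_def)
    then show ?thesis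
      by (simp add: closed_adj_def Const_diff Const_mult)
  qed
  define y where "y i = Var (Suc i) ^ 2" for i
  define Q where "Q i j = closed_adj E (Suc i) (Suc j)" for i j
  have shift: "(\<Sum>i=1..n. g i) = (\<Sum>i=0..<n. g (Suc i))" for g :: "nat \<Rightarrow> mpoly"
    using sum.shift_bounds_Suc_ivl[of g 0 n] by (simp add: atLeastLessThanSuc_atLeastAtMost)
  have "graph_poly n E = (\<Sum>i=0..<n. y i * (\<Sum>j=0..<n. (Const \<alpha> * Q i j - 1) * y j))"
    unfolding graph_poly_def quartic_form_def sq_vars_def scalar_prod_def
    using graph_mat_carrier[of n E]
    by (auto intro!: sum.cong simp: scalar_prod_def entry y_def Q_def)
  also have "\<dots> = (\<Sum>i=0..<n. \<Sum>j=0..<n. Const \<alpha> * (Q i j * y i * y j) - y i * y j)"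
    unfolding sum_distrib_left by (intro sum.cong refl) (simp add: algebra_simps)
  also have "\<dots> = Const \<alpha> * (\<Sum>i=0..<n. \<Sum>j=0..<n. Q i j * y i * y j)
      - (\<Sum>i=0..<n. y i) * (\<Sum>j=0..<n. y j)"
    unfolding sum_product by (simp only: sum_subtractf sum_distrib_left)
  also have "\<dots> = Const \<alpha> * closed_adj_form E {1..n} - vertex_sum {1..n} ^ 2"
    unfolding closed_adj_form_def vertex_sum_def shift y_def Q_def
    by (simp only: power2_eq_square[of "sum _ _"])
  finally show ?thesis
    unfolding \<alpha>_def .
qed

theorem theorem4:
  fixes n :: nat and E :: "nat set set"
  assumes "simple_graph n E"
  shows "reznick_certifiable n (graph_mat n E) \<and>
    (\<exists>r::nat. (\<Sum>i=1..n. Var i ^ 2) ^ r * graph_poly n E \<in> sos n)"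
proof -
  have "\<exists>r::nat. (\<Sum>i=1..n. Var i ^ 2) ^ r * graph_poly n E \<in> sos n"
    using exists_sos_stable_bound[OF assms subset_refl card_stable_le_stability_number]
    unfolding graph_poly_eq[OF assms] vertex_sum_def .
  then show ?thesis
    unfolding reznick_certifiable_def using graph_mat_carrier[of n E] transpose_graph_mat[of n E]
    by (simp add: graph_poly_def)
qed

end
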